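(* Let $a,b\in\mathbb{R}$ with $0<a<b$. Then, for all $q>1$, with $p$ defined by $\frac1p+\frac1q=1$, $$\left|A(a,b)^{-1}-L(a,b)^{-1}\right|\leq\frac{b-a}{(ab)^{2}}\left(\frac{2}{(p+1)(p+2)}\right)^{\frac1p}\left[A\left(|a|^{2q},|b|^{2q}\right)\right]^{\frac1q}.$$
   Context: For $a,b\ge 0$, the arithmetic mean is $A(a,b)=\frac{a+b}{2}$. For $a,b>0$ with $a\neq b$, the logarithmic mean is $L(a,b)=\frac{b-a}{\ln b-\ln a}$ (and $L(a,a)=a$). *)

theory Defs
  imports Complex_Main
begin

definition arith_mean :: "real \<Rightarrow> real \<Rightarrow> real" where
  "arith_mean a b = (a + b) / 2"

text \<open>The logarithmic mean is meaningful for positive arguments only.\<close>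

definition log_mean :: "real \<Rightarrow> real \<Rightarrow> real" where
  "log_mean a b = (if a = b then a else (b - a) / (ln b - ln a))"

end

theory Submission
  imports Defs "HOL-Analysis.Harmonic_Numbers"
begin

text \<open>
  Both sides are compared with \<open>(b - a) (a\<^sup>2 + b\<^sup>2) / (6 a\<^sup>2 b\<^sup>2)\<close>. The trapezoidal bound
  \<open>1/L \<le> (a + b) / (2 a b)\<close> and the midpoint bound \<open>1/A \<le> 1/L\<close> show that the left-hand side is at
  most \<open>(b - a)\<^sup>2 / (2 a b (a + b))\<close>, hence at most this quantity. On the right-hand side, the
  power mean inequality bounds the last factor below by \<open>(a\<^sup>2 + b\<^sup>2) / 2\<close>, and
  \<open>(p + 1) (p + 2) \<le> 2 \<cdot> 3\<^sup>p\<close> bounds the factor with exponent \<open>1/p\<close> below by \<open>1/3\<close>.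
\<close>

text \<open>\<open>1/L\<close> is the average of \<open>1/x\<close> over \<open>[a, b]\<close>, so
  these are the two Hermite-Hadamard bounds for the convex function \<open>1/x\<close>.\<close>

lemma inverse_log_mean_bounds:
  assumes "0 < a" "a < b"
  shows "2 / (a + b) \<le> inverse (log_mean a b)"
    and "inverse (log_mean a b) \<le> (a + b) / (2 * a * b)"
proof -
  have eq: "inverse (log_mean a b) = (ln b - ln a) / (b - a)"
    using assms by (simp add: log_mean_def)
  show "2 / (a + b) \<le> inverse (log_mean a b)"
    using ln_inverse_approx_ge[OF assms] assms unfolding eq by (simp add: pos_le_divide_eq)
  have "(b - a) * (inverse a + inverse b) / 2 = (a + b) / (2 * a * b) * (b - a)"
    using assms by (simp add: field_simps)
  then show "inverse (log_mean a b) \<le> (a + b) / (2 * a * b)"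
    using ln_inverse_approx_le[of a "b - a"] assms unfolding eq by (simp add: pos_divide_le_eq)
qed

lemma abs_inverse_arith_mean_diff_log_mean_le:
  assumes "0 < a" "a < b"
  shows "\<bar>inverse (arith_mean a b) - inverse (log_mean a b)\<bar>
    \<le> (b - a) / (a * b)\<^sup>2 * (1 / 3 * ((a\<^sup>2 + b\<^sup>2) / 2))"
proof -
  have "\<bar>inverse (arith_mean a b) - inverse (log_mean a b)\<bar>
      \<le> (a + b) / (2 * a * b) - 2 / (a + b)"
    using inverse_log_mean_bounds[OF assms] by (simp add: arith_mean_def)
  also have "\<dots> = (b - a) / (a * b)\<^sup>2 * (a * b * (b - a) / (2 * (a + b)))"
    using assms by (simp add: divide_simps) (simp add: power2_eq_square algebra_simps)
  also have "\<dots> \<le> (b - a) / (a * b)\<^sup>2 * (1 / 3 * ((a\<^sup>2 + b\<^sup>2) / 2))"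
  proof (rule mult_left_mono)
    \<comment> \<open>Clearing denominators leaves a cubic inequality; the gap is split into visibly
      nonnegative terms.\<close>
    have "(a\<^sup>2 + b\<^sup>2) * (a + b) - 3 * (a * b * (b - a)) = a ^ 3 + 3 * a\<^sup>2 * b + b * (a - b)\<^sup>2"
      by (simp add: power2_eq_square power3_eq_cube algebra_simps)
    moreover have "\<dots> \<ge> 0"
      using assms by simp
    ultimately have "3 * (a * b * (b - a)) \<le> (a\<^sup>2 + b\<^sup>2) * (a + b)"
      by linarith
    then show "a * b * (b - a) / (2 * (a + b)) \<le> 1 / 3 * ((a\<^sup>2 + b\<^sup>2) / 2)"
      using assms by (simp add: field_simps)
  qed (use assms in simp)
  finally show ?thesis .
qed

lemma one_third_le_powr:
  fixes p :: real
  assumes "1 \<le> p"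
  shows "1 / 3 \<le> (2 / ((p + 1) * (p + 2))) powr (1 / p)"
proof -
  \<comment> \<open>Equality holds at \<open>p = 1\<close>, so the estimate is expanded around that
    point.\<close>
  define t where "t = p - 1"
  have t: "0 \<le> t" "p = t + 1"
    using assms by (auto simp: t_def)
  have "(1::real) \<le> ln 3"
    using exp_le by (simp add: ln_ge_iff)
  then have "t \<le> t * ln 3"
    using t by (simp add: mult_le_cancel_left1)
  \<comment> \<open>The product is \<open>t\<^sup>2 + 5 * t + 6\<close>; enlarging its first two
    coefficients to 3 and 6 gives six times the quadratic Taylor polynomial of
    \<open>exp\<close>.\<close>
  have "(p + 1) * (p + 2) \<le> 6 * (1 + t + t\<^sup>2 / 2)"
    using t by (simp add: power2_eq_square algebra_simps)
  also have "\<dots> \<le> 6 * exp t"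
    using exp_lower_Taylor_quadratic[OF t(1)] by simp
  also have "\<dots> \<le> 6 * 3 powr t"
    using \<open>t \<le> t * ln 3\<close> by (simp add: powr_def)
  also have "\<dots> = 2 * 3 powr p"
    by (simp add: t(2) powr_add)
  finally have "(1 / 3) powr p \<le> 2 / ((p + 1) * (p + 2))"
    using assms by (simp add: powr_divide divide_simps mult.commute)
  then have "((1 / 3) powr p) powr (1 / p) \<le> (2 / ((p + 1) * (p + 2))) powr (1 / p)"
    using assms by (intro powr_mono2) auto
  then show ?thesis
    using assms by (simp add: powr_powr)
qed

text \<open>Jensen's inequality for the convex map \<open>x powr q\<close> with equal weights,
  followed by the \<open>q\<close>-th root.\<close>

lemma powr_mean_ge:
  fixes x y q :: real
  assumes "0 < x" "0 < y" "1 \<le> q"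
  shows "(x + y) / 2 \<le> ((x powr q + y powr q) / 2) powr (1 / q)"
proof -
  have "((x + y) / 2) powr q \<le> (x powr q + y powr q) / 2"
    using convex_onD[OF powr_convex[of q], of "1/2" x y] assms by (simp add: field_simps)
  then have "(((x + y) / 2) powr q) powr (1 / q) \<le> ((x powr q + y powr q) / 2) powr (1 / q)"
    using assms by (intro powr_mono2) auto
  then show ?thesis
    using assms by (simp add: powr_powr)
qed

theorem proposition4:
  fixes a b p q :: real
  assumes "0 < a" and "a < b"
    and "q > 1" and "1 / p + 1 / q = 1"
  shows "\<bar>inverse (arith_mean a b) - inverse (log_mean a b)\<bar>
    \<le> (b - a) / (a * b)\<^sup>2 * (2 / ((p + 1) * (p + 2))) powr (1 / p)
        * (arith_mean (\<bar>a\<bar> powr (2 * q)) (\<bar>b\<bar> powr (2 * q))) powr (1 / q)"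
proof -
  \<comment> \<open>Strict positivity of \<open>1 / p\<close> also excludes \<open>p = 0\<close>,
    where \<open>1 / p\<close> would be 0.\<close>
  have "0 < 1 / p" "1 / p < 1"
    using assms(3,4) by (auto simp: eq_diff_eq[symmetric])
  then have "1 \<le> p"
    by (simp add: divide_simps split: if_splits)
  have sq: "x\<^sup>2 powr q = \<bar>x\<bar> powr (2 * q)" if "0 < x" for x :: real
    using that by (simp add: powr_powr flip: powr_numeral)
  have "(a\<^sup>2 + b\<^sup>2) / 2
      \<le> (arith_mean (\<bar>a\<bar> powr (2 * q)) (\<bar>b\<bar> powr (2 * q))) powr (1 / q)"
    using powr_mean_ge[of "a\<^sup>2" "b\<^sup>2" q] assms by (simp add: arith_mean_def sq)
  then have "1 / 3 * ((a\<^sup>2 + b\<^sup>2) / 2) \<le> (2 / ((p + 1) * (p + 2))) powr (1 / p)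
        * (arith_mean (\<bar>a\<bar> powr (2 * q)) (\<bar>b\<bar> powr (2 * q))) powr (1 / q)"
    using one_third_le_powr[OF \<open>1 \<le> p\<close>] by (intro mult_mono) auto
  then have "(b - a) / (a * b)\<^sup>2 * (1 / 3 * ((a\<^sup>2 + b\<^sup>2) / 2))
      \<le> (b - a) / (a * b)\<^sup>2 * ((2 / ((p + 1) * (p + 2))) powr (1 / p)
        * (arith_mean (\<bar>a\<bar> powr (2 * q)) (\<bar>b\<bar> powr (2 * q))) powr (1 / q))"
    using assms by (intro mult_left_mono) auto
  then show ?thesis
    using abs_inverse_arith_mean_diff_log_mean_le[OF assms(1,2)] by (simp add: mult.assoc)
qed

end
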